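(* Let $d\ge 3$ be an odd integer and let $\rho$ be a quantum state of dimension $d$, i.e. a complex Hermitian positive semidefinite $d\times d$ matrix with $\operatorname{Tr}\rho=1$. If $S_{\mathrm R}=S_{\mathrm R}(\rho)$ satisfies $S_{\mathrm R}\le \frac{1}{\sqrt{d-1}}$, then $$\sqrt d\; S_{\mathrm I}\ \le\ \sqrt{d-1}+S_{\mathrm R},$$ where $S_{\mathrm I}=S_{\mathrm I}(\rho)$.
   Context: Write $\rho=\frac1d(R+I)$, where $R=\frac d2(\rho+\rho^T)$ is the (real symmetric) real part and $I=\frac d2(\rho-\rho^T)$ is the purely imaginary, skew-symmetric (Hermitian) part; here $^T$ denotes the transpose and $I$ is not the identity matrix. Write further $R=\mathbb 1_d+D+X$, where $\mathbb 1_d$ is the identity matrix, $D$ is the real traceless diagonal matrix whose diagonal entries are those of $R-\mathbb 1_d$, and $X$ is the real symmetric off-diagonal part of $R$ (zero diagonal). Define the nonnegative numbers $$S_{\mathrm D}=\sqrt{\operatorname{Tr}(D^2)/d},\quad S_{\mathrm X}=\sqrt{\operatorname{Tr}(X^2)/d},\quad S_{\mathrm I}=\sqrt{\operatorname{Tr}(I^2)/d},\quad S_{\mathrm R}=\sqrt{S_{\mathrm D}^2+S_{\mathrm X}^2},$$ so that $S_{\mathrm R}^2=\operatorname{Tr}(R^2)/d-1$. *)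

theory Defs
  imports "HOL-Analysis.Analysis"
begin

definition conj_transpose :: "complex^'n^'m \<Rightarrow> complex^'m^'n" where
  "conj_transpose A = (\<chi> i j. cnj (A $ j $ i))"

definition hermitian :: "complex^'n^'n \<Rightarrow> bool" where
  "hermitian A \<longleftrightarrow> conj_transpose A = A"

text \<open>The quadratic form of a Hermitian matrix is real-valued, so taking its real part loses
  nothing. The type \<^typ>\<open>complex^'n\<close> carries only a real inner product, hence the explicit sum.\<close>

definition pos_semidef :: "complex^'n^'n \<Rightarrow> bool" where
  "pos_semidef A \<longleftrightarrow>
     hermitian A \<and> (\<forall>v. 0 \<le> Re (\<Sum>i\<in>UNIV. cnj (v $ i) * (A *v v) $ i))"

definition quantum_state :: "complex^'n^'n \<Rightarrow> bool" where
  "quantum_state \<rho> \<longleftrightarrow> pos_semidef \<rho> \<and> trace \<rho> = 1"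

definition R_part :: "complex^'n^'n \<Rightarrow> complex^'n^'n" where
  "R_part \<rho> = (real CARD('n) / 2) *\<^sub>R (\<rho> + transpose \<rho>)"

definition I_part :: "complex^'n^'n \<Rightarrow> complex^'n^'n" where
  "I_part \<rho> = (real CARD('n) / 2) *\<^sub>R (\<rho> - transpose \<rho>)"

definition D_part :: "complex^'n^'n \<Rightarrow> complex^'n^'n" where
  "D_part \<rho> = (\<chi> i j. if i = j then (R_part \<rho> - mat 1) $ i $ j else 0)"

definition X_part :: "complex^'n^'n \<Rightarrow> complex^'n^'n" where
  "X_part \<rho> = (\<chi> i j. if i = j then 0 else R_part \<rho> $ i $ j)"

text \<open>For a Hermitian \<^term>\<open>\<rho>\<close> the parts are Hermitian as well, so the traces of their squares
  are nonnegative real numbers.\<close>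

definition S_D :: "complex^'n^'n \<Rightarrow> real" where
  "S_D \<rho> = sqrt (Re (trace (D_part \<rho> ** D_part \<rho>)) / real CARD('n))"

definition S_X :: "complex^'n^'n \<Rightarrow> real" where
  "S_X \<rho> = sqrt (Re (trace (X_part \<rho> ** X_part \<rho>)) / real CARD('n))"

definition S_I :: "complex^'n^'n \<Rightarrow> real" where
  "S_I \<rho> = sqrt (Re (trace (I_part \<rho> ** I_part \<rho>)) / real CARD('n))"

definition S_R :: "complex^'n^'n \<Rightarrow> real" where
  "S_R \<rho> = sqrt ((S_D \<rho>)\<^sup>2 + (S_X \<rho>)\<^sup>2)"

lemma state_decomposition:
  fixes \<rho> :: "complex^'n^'n"
  shows "\<rho> = (1 / real CARD('n)) *\<^sub>R (R_part \<rho> + I_part \<rho>)"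
proof -
  have "R_part \<rho> + I_part \<rho> = (real CARD('n) / 2) *\<^sub>R (\<rho> + \<rho>)"
    by (simp add: R_part_def I_part_def flip: scaleR_right_distrib)
  also have "\<dots> = real CARD('n) *\<^sub>R \<rho>"
    by (simp flip: scaleR_2)
  finally show ?thesis by simp
qed

lemma R_part_decomposition: "R_part \<rho> = mat 1 + D_part \<rho> + X_part \<rho>"
  by (simp add: D_part_def X_part_def vec_eq_iff mat_def)

end

theory Submission
  imports Defs
begin

text \<open>Write $d$ for the dimension and $d\rho = R + iK$ with $R$ real symmetric and $K$ real
  skew-symmetric. As $d$ is odd, $K v = 0$ for some real unit vector $v$. The Schur complement $C$ of
  $d\rho$ at $v$ is positive semidefinite, and two positive semidefinite matrices have a nonnegative
  sum of entrywise products; applied to $C$ and $d\rho$ this improves the purity bound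
  $\|K\|^2 \le \|R\|^2$ to $\|K\|^2 \le \|R\|^2 - (v \cdot R v)^2$. The traceless matrix
  $E = R - 1$ satisfies $\|E\|^2 = d S_R^2$, and Cauchy-Schwarz against the traceless matrix
  $v v^T - 1/d$ gives $|v \cdot E v| \le t := \sqrt{d - 1}\, S_R \le 1$. Therefore
  $\|K\|^2 \le d + d S_R^2 - (1 - t)^2 = (\sqrt{d - 1} + S_R)^2$.\<close>

section \<open>Sesquilinear forms, Schur complements and entrywise products\<close>

definition sesqui :: "complex^'n^'n \<Rightarrow> complex^'n \<Rightarrow> complex^'n \<Rightarrow> complex" where
  "sesqui A x y = (\<Sum>i\<in>UNIV. cnj (x $ i) * (A *v y) $ i)"

lemma sesqui_double_sum:
  "sesqui A x y = (\<Sum>i\<in>UNIV. \<Sum>j\<in>UNIV. cnj (x $ i) * A $ i $ j * y $ j)"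
  by (simp add: sesqui_def matrix_vector_mult_def sum_distrib_left mult.assoc)

lemma sesqui_add_left: "sesqui A (x + y) z = sesqui A x z + sesqui A y z"
  by (simp add: sesqui_def distrib_right sum.distrib)

lemma sesqui_add_right: "sesqui A x (y + z) = sesqui A x y + sesqui A x z"
  by (simp add: sesqui_def matrix_vector_right_distrib distrib_left sum.distrib)

lemma sesqui_scale_left: "sesqui A (c *s x) y = cnj c * sesqui A x y"
  by (simp add: sesqui_def sum_distrib_left mult.assoc)

lemma sesqui_scale_right: "sesqui A x (c *s y) = c * sesqui A x y"
  by (simp add: sesqui_double_sum sum_distrib_left mult_ac)

lemma sesqui_axis_left: "sesqui A (axis i 1) y = (A *v y) $ i"
proof -
  have "sesqui A (axis i 1) y = (\<Sum>k\<in>UNIV. if k = i then (A *v y) $ k else 0)"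
    unfolding sesqui_def axis_def by (rule sum.cong) auto
  then show ?thesis by simp
qed

lemma matrix_vector_axis: "(A *v axis j 1) $ i = (A :: complex^'n^'m) $ i $ j"
  by (simp add: matrix_vector_mult_def axis_def if_distrib cong: if_cong)

lemma hermitian_component: "hermitian A \<Longrightarrow> cnj (A $ j $ i) = A $ i $ j"
  by (auto simp: hermitian_def conj_transpose_def vec_eq_iff)

lemma sesqui_hermitian:
  assumes "hermitian A"
  shows "sesqui A y x = cnj (sesqui A x y)"
  unfolding sesqui_double_sum
  by (subst sum.swap) (simp add: hermitian_component[OF assms] mult_ac)

lemma sesqui_self_real: "hermitian A \<Longrightarrow> sesqui A x x = of_real (Re (sesqui A x x))"
  using sesqui_hermitian[of A x x] by (simp add: complex_eq_iff)

lemma sesqui_expand: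
  assumes "hermitian A"
  shows "Re (sesqui A (x + c *s y) (x + c *s y)) =
    Re (sesqui A x x) + 2 * Re (cnj c * sesqui A y x) + (norm c)\<^sup>2 * Re (sesqui A y y)"
proof -
  have "Re (c * cnj (sesqui A y x)) = Re (cnj c * sesqui A y x)"
    by simp
  moreover have "Re (c * (cnj c * z)) = (norm c)\<^sup>2 * Re z" for z
    unfolding cmod_power2 by (simp add: algebra_simps power2_eq_square)
  ultimately show ?thesis
    by (simp only: sesqui_add_left sesqui_add_right sesqui_scale_left sesqui_scale_right
        sesqui_hermitian[OF assms, of x y] plus_complex.sel distrib_left)
qed

lemma pos_semidef_sesqui:
  "pos_semidef A \<longleftrightarrow> hermitian A \<and> (\<forall>v. 0 \<le> Re (sesqui A v v))"
  by (simp add: pos_semidef_def sesqui_def)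

text \<open>The form is nonnegative at \<open>x - (t * s) *s y\<close> for every real
  \<open>t\<close>. Putting \<open>s = sesqui A y x\<close> into the coefficient makes the cross
  term real, which leaves a real quadratic in \<open>t\<close>.\<close>

lemma pos_semidef_Cauchy_Schwarz:
  assumes "pos_semidef A"
  shows "(norm (sesqui A x y))\<^sup>2 \<le> Re (sesqui A x x) * Re (sesqui A y y)"
proof -
  have herm: "hermitian A" and nonneg: "\<And>v. 0 \<le> Re (sesqui A v v)"
    using assms by (auto simp: pos_semidef_sesqui)
  define s where "s = sesqui A y x"
  have norm_s: "norm (sesqui A x y) = norm s"
    by (simp add: s_def sesqui_hermitian[OF herm, of y x])
  have key: "0 \<le> Re (sesqui A x x) - 2 * t * (norm s)\<^sup>2 + t\<^sup>2 * (norm s)\<^sup>2 * Re (sesqui A y y)"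
    for t :: real
  proof -
    have "Re (cnj (- of_real t * s) * s) = - t * (norm s)\<^sup>2"
      unfolding cmod_power2 by (simp add: algebra_simps power2_eq_square)
    moreover have "(norm (- of_real t * s))\<^sup>2 = t\<^sup>2 * (norm s)\<^sup>2"
      by (simp add: norm_mult power_mult_distrib)
    ultimately show ?thesis
      using nonneg[of "x + (- of_real t * s) *s y"] sesqui_expand[OF herm, of x "- of_real t * s" y]
      by (simp flip: s_def)
  qed
  show ?thesis
  proof (cases "Re (sesqui A y y) = 0")
    case True
    have "norm s = 0"
    proof (rule ccontr)
      assume "norm s \<noteq> 0"
      then show False
        \<comment> \<open>The quadratic is affine here, and this \<open>t\<close> gives it the value
          -1.\<close>
        using key[of "(Re (sesqui A x x) + 1) / (2 * (norm s)\<^sup>2)"] True nonneg[of x]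
        by (simp add: field_simps)
    qed
    then show ?thesis using True norm_s by simp
  next
    case False
    then have pos: "Re (sesqui A y y) > 0" using nonneg[of y] by simp
    show ?thesis
      using key[of "1 / Re (sesqui A y y)"] pos norm_s
      by (simp add: field_simps power2_eq_square)
  qed
qed

text \<open>Cauchy-Schwarz against each coordinate vector bounds the entries of
  \<open>A *v y\<close> by zero.\<close>

lemma pos_semidef_kernel:
  assumes "pos_semidef A" "sesqui A y y = 0"
  shows "A *v y = 0"
proof -
  have "(A *v y) $ i = 0" for i
    using pos_semidef_Cauchy_Schwarz[OF assms(1), of "axis i 1" y] assms(2)
    by (simp add: sesqui_axis_left)
  then show ?thesis by (simp add: vec_eq_iff)
qed

text \<open>For \<^term>\<open>sesqui A y y = 0\<close> division by zero makes this \<^term>\<open>A\<close> itself, which is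
  the right value for positive semidefinite \<^term>\<open>A\<close> because then \<^term>\<open>A *v y = 0\<close>.\<close>

definition schur_complement :: "complex^'n^'n \<Rightarrow> complex^'n \<Rightarrow> complex^'n^'n" where
  "schur_complement A y =
     (\<chi> i j. A $ i $ j - (A *v y) $ i * cnj ((A *v y) $ j) / sesqui A y y)"

text \<open>The subtracted matrix is a multiple of the outer product of \<open>A *v y\<close> with
  itself, so its form factors; hermiticity identifies the second factor as
  \<open>sesqui A y z\<close>.\<close>

lemma sesqui_schur_complement:
  assumes "hermitian A"
  shows "sesqui (schur_complement A y) x z =
    sesqui A x z - sesqui A x y * sesqui A y z / sesqui A y y"
proof -
  have "sesqui A y z = (\<Sum>j\<in>UNIV. cnj ((A *v y) $ j) * z $ j)"
    using sesqui_hermitian[OF assms, of y z] by (simp add: sesqui_def mult.commute)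
  moreover have "sesqui A x y = (\<Sum>i\<in>UNIV. cnj (x $ i) * (A *v y) $ i)"
    by (simp add: sesqui_def)
  ultimately have "sesqui A x y * sesqui A y z / sesqui A y y =
    (\<Sum>i\<in>UNIV. \<Sum>j\<in>UNIV. cnj (x $ i) * ((A *v y) $ i * cnj ((A *v y) $ j) / sesqui A y y) * z $ j)"
    by (simp only: sum_product sum_divide_distrib) (simp add: mult_ac)
  then show ?thesis
    by (simp add: sesqui_double_sum[of _ x z] schur_complement_def algebra_simps sum_subtractf)
qed

text \<open>Nonnegativity of the new form is Cauchy-Schwarz for \<open>A\<close> divided by
  \<open>sesqui A y y\<close>.\<close>

lemma pos_semidef_schur_complement:
  assumes "pos_semidef A"
  shows "pos_semidef (schur_complement A y)"
proof -
  have herm: "hermitian A" and nonneg: "\<And>v. 0 \<le> Re (sesqui A v v)"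
    using assms by (auto simp: pos_semidef_sesqui)
  have real: "cnj (sesqui A y y) = sesqui A y y"
    using sesqui_hermitian[OF herm, of y y] by simp
  have "hermitian (schur_complement A y)"
    by (simp add: hermitian_def conj_transpose_def schur_complement_def vec_eq_iff real
        hermitian_component[OF herm] mult.commute)
  moreover have "0 \<le> Re (sesqui (schur_complement A y) x x)" for x
  proof -
    have "sesqui A x y * sesqui A y x / sesqui A y y
        = of_real ((norm (sesqui A x y))\<^sup>2 / Re (sesqui A y y))"
      by (subst sesqui_self_real[OF herm, of y], subst sesqui_hermitian[OF herm, of y x])
         (simp add: complex_norm_square del: of_real_power flip: of_real_power)
    then have "Re (sesqui (schur_complement A y) x x)
        = Re (sesqui A x x) - (norm (sesqui A x y))\<^sup>2 / Re (sesqui A y y)"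
      by (simp add: sesqui_schur_complement[OF herm])
    moreover have "(norm (sesqui A x y))\<^sup>2 / Re (sesqui A y y) \<le> Re (sesqui A x x)"
      using pos_semidef_Cauchy_Schwarz[OF assms, of x y] nonneg[of x] nonneg[of y]
      by (cases "Re (sesqui A y y) = 0") (simp_all add: divide_le_eq)
    ultimately show ?thesis by simp
  qed
  ultimately show ?thesis by (simp add: pos_semidef_sesqui)
qed

text \<open>Splits off the rank-one part of \<open>A\<close>. The entrywise product carries no
  conjugation, so pairing that part with \<open>B\<close> evaluates the form of \<open>B\<close> at
  the conjugate of \<open>A *v y\<close>.\<close>

lemma sum_entries_schur_complement:
  fixes A B :: "complex^'n^'n"
  shows
  "(\<Sum>i\<in>UNIV. \<Sum>j\<in>UNIV. A $ i $ j * B $ i $ j) =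
    (\<Sum>i\<in>UNIV. \<Sum>j\<in>UNIV. schur_complement A y $ i $ j * B $ i $ j) +
    sesqui B (\<chi> i. cnj ((A *v y) $ i)) (\<chi> i. cnj ((A *v y) $ i)) / sesqui A y y"
  unfolding sesqui_double_sum[of B]
  by (simp add: schur_complement_def sum_divide_distrib mult_ac left_diff_distrib flip: sum.distrib)
     (simp add: algebra_simps)

text \<open>Passing to the Schur complement at a unit vector clears one row and column of
  \<^term>\<open>A\<close>, so one inducts on a set outside which the rows of \<^term>\<open>A\<close> vanish.\<close>

lemma pos_semidef_sum_entries_nonneg:
  fixes A B :: "complex^'n^'n"
  assumes "pos_semidef A" "pos_semidef B"
  shows "0 \<le> Re (\<Sum>i\<in>UNIV. \<Sum>j\<in>UNIV. A $ i $ j * B $ i $ j)"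
proof -
  have "0 \<le> Re (\<Sum>i\<in>UNIV. \<Sum>j\<in>UNIV. A $ i $ j * B $ i $ j)"
    if "finite S" "pos_semidef A" "\<forall>i j. i \<notin> S \<longrightarrow> A $ i $ j = 0" for S and A :: "complex^'n^'n"
    using that
  proof (induction S arbitrary: A)
    case empty
    then show ?case by simp
  next
    case (insert p S)
    let ?y = "axis p 1 :: complex^'n" and ?C = "schur_complement A (axis p 1)"
    have herm: "hermitian A"
      using insert.prems by (simp add: pos_semidef_sesqui)
    have q: "sesqui A ?y ?y = A $ p $ p"
      by (simp add: sesqui_axis_left matrix_vector_axis)
    have entry: "?C $ i $ j = A $ i $ j - A $ i $ p * A $ p $ j / A $ p $ p" for i j
      by (simp add: schur_complement_def q matrix_vector_axis hermitian_component[OF herm])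
    have "?C $ i $ j = 0" if "i \<notin> S" for i j
    proof (cases "i = p")
      case True
      \<comment> \<open>A zero pivot eliminates nothing, but positivity then forces column
        \<open>p\<close> of \<open>A\<close> to vanish, and hermiticity carries this over to row
        \<open>p\<close>.\<close>
      have "A $ p $ j = 0" if "A $ p $ p = 0"
        using pos_semidef_kernel[OF insert.prems(1), of ?y] that q
          hermitian_component[OF herm, of j p]
        by (metis complex_cnj_zero matrix_vector_axis zero_index)
      then show ?thesis by (cases "A $ p $ p = 0") (simp_all add: entry True)
    next
      case False
      then show ?thesis using insert.prems(2) that by (simp add: entry)
    qed
    then have "0 \<le> Re (\<Sum>i\<in>UNIV. \<Sum>j\<in>UNIV. ?C $ i $ j * B $ i $ j)"
      using insert.IH pos_semidef_schur_complement[OF insert.prems(1)] by blast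
    moreover have "0 \<le> Re (sesqui B z z / sesqui A ?y ?y)" for z
    proof -
      have "Re (sesqui B z z / sesqui A ?y ?y) = Re (sesqui B z z) / Re (sesqui A ?y ?y)"
        by (subst sesqui_self_real[OF herm, of ?y]) simp
      then show ?thesis
        using insert.prems(1) assms(2) by (simp add: pos_semidef_sesqui)
    qed
    ultimately show ?case
      by (subst sum_entries_schur_complement[where y = ?y]) simp
  qed
  from this[of UNIV A] assms show ?thesis by simp
qed

section \<open>Real matrices: kernel vectors and quadratic forms\<close>

definition Re_matrix :: "complex^'n^'m \<Rightarrow> real^'n^'m" where
  "Re_matrix A = (\<chi> i j. Re (A $ i $ j))"

definition Im_matrix :: "complex^'n^'m \<Rightarrow> real^'n^'m" where
  "Im_matrix A = (\<chi> i j. Im (A $ i $ j))"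

lemma inner_matrix: "(A :: real^'n^'m) \<bullet> B = (\<Sum>i\<in>UNIV. \<Sum>j\<in>UNIV. A $ i $ j * B $ i $ j)"
  by (simp add: inner_vec_def)

lemma inner_mat_1: "(A :: real^'n^'n) \<bullet> mat 1 = trace A"
  by (simp add: inner_matrix mat_def trace_def if_distrib cong: if_cong)

text \<open>On the kernel vector \<open>A\<close> acts as its real part, so
  \<open>w = A *v y\<close> is real. Splitting the sum of squared entries at \<open>y\<close> leaves
  a nonnegative sum plus \<open>sesqui A w w / r\<close>, and Cauchy-Schwarz makes the last term at
  least \<open>r\<^sup>2\<close>.\<close>

lemma pos_semidef_real_kernel_bound:
  fixes v :: "real^'n"
  assumes psd: "pos_semidef A" and unit: "norm v = 1" and ker: "Im_matrix A *v v = 0"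
  shows "(v \<bullet> (Re_matrix A *v v))\<^sup>2
    \<le> Re_matrix A \<bullet> Re_matrix A - Im_matrix A \<bullet> Im_matrix A"
proof -
  have herm: "hermitian A" and nonneg: "\<And>x. 0 \<le> Re (sesqui A x x)"
    using psd by (auto simp: pos_semidef_sesqui)
  define r u where "r = v \<bullet> (Re_matrix A *v v)" and "u = Re_matrix A *v v"
  define y w where "y = (\<chi> i. complex_of_real (v $ i))" and "w = (\<chi> i. complex_of_real (u $ i))"
  let ?C = "schur_complement A y"
  have "(\<Sum>j\<in>UNIV. Im (A $ i $ j) * v $ j) = 0" for i
    using ker by (simp add: vec_eq_iff matrix_vector_mult_def Im_matrix_def)
  then have Ay: "A *v y = w"
    by (simp add: vec_eq_iff matrix_vector_mult_def Re_matrix_def complex_eq_iff y_def w_def u_def)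
  have q: "sesqui A y y = of_real r"
    by (simp add: sesqui_def Ay) (simp add: y_def w_def r_def u_def inner_vec_def)
  have N: "sesqui A w y = of_real (u \<bullet> u)"
    by (simp add: sesqui_def Ay) (simp add: y_def w_def inner_vec_def)
  \<comment> \<open>The entries are squared without conjugation, so imaginary parts count
    negatively.\<close>
  have squares: "Re (\<Sum>i\<in>UNIV. \<Sum>j\<in>UNIV. A $ i $ j * A $ i $ j)
      = Re_matrix A \<bullet> Re_matrix A - Im_matrix A \<bullet> Im_matrix A"
    by (simp add: inner_matrix Re_matrix_def Im_matrix_def sum_subtractf)
  have "r\<^sup>2 \<le> Re (\<Sum>i\<in>UNIV. \<Sum>j\<in>UNIV. A $ i $ j * A $ i $ j)"
  proof (cases "r = 0")
    case True
    then show ?thesis using pos_semidef_sum_entries_nonneg[OF psd psd] by simp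
  next
    case False
    then have r: "r > 0" using nonneg[of y] q by simp
    \<comment> \<open>This is Cauchy-Schwarz for \<open>w\<close> and \<open>y\<close>, where
      \<open>sesqui A w y\<close> is the squared length of \<open>u\<close>.\<close>
    have "0 \<le> Re (sesqui ?C w w)"
      using pos_semidef_schur_complement[OF psd, of y] by (simp add: pos_semidef_sesqui)
    then have ge: "(u \<bullet> u)\<^sup>2 / r \<le> Re (sesqui A w w)"
      by (simp add: sesqui_schur_complement[OF herm] sesqui_hermitian[OF herm, of y w] q N
          power2_eq_square)
    have "\<bar>r\<bar> \<le> norm u"
      using Cauchy_Schwarz_ineq2[of v u] unit by (simp add: r_def u_def)
    then have "r\<^sup>2 \<le> u \<bullet> u"
      using power_mono[of "\<bar>r\<bar>" "norm u" 2] by (simp add: power2_norm_eq_inner)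
    then have "(r\<^sup>2)\<^sup>2 \<le> (u \<bullet> u)\<^sup>2"
      by (rule power_mono) simp
    then have "r\<^sup>2 \<le> (u \<bullet> u)\<^sup>2 / r / r"
      using r by (simp add: field_simps power2_eq_square)
    also have "\<dots> \<le> Re (sesqui A w w / sesqui A y y)"
      using divide_right_mono[OF ge, of r] r by (simp add: q)
    also have "\<dots> \<le> Re (\<Sum>i\<in>UNIV. \<Sum>j\<in>UNIV. A $ i $ j * A $ i $ j)"
    proof -
      have "(\<chi> i. cnj ((A *v y) $ i)) = w"
        by (simp add: Ay vec_eq_iff) (simp add: w_def)
      then show ?thesis
        using sum_entries_schur_complement[of A A y]
          pos_semidef_sum_entries_nonneg[OF pos_semidef_schur_complement[OF psd] psd, of y]
        by simp
    qed
    finally show ?thesis .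
  qed
  then show ?thesis by (simp only: squares r_def)
qed

text \<open>In odd dimension negation flips the sign of the determinant while transposition
  preserves it, so \<open>det A = 0\<close>.\<close>

lemma odd_skew_symmetric_kernel:
  fixes A :: "real^'n^'n"
  assumes "odd CARD('n)" "transpose A = - A"
  obtains v where "norm v = 1" "A *v v = 0"
proof -
  have "- A = (\<chi> i. (-1) *s A $ i)"
    by (simp add: vec_eq_iff)
  then have "det (- A) = (\<Prod>i\<in>(UNIV :: 'n set). -1) * det (\<chi> i. A $ i)"
    by (simp only: det_rows_mul)
  then have "det (- A) = - det A"
    using assms(1) by simp
  then have "det A = 0"
    using det_transpose[of A] assms(2) by simp
  then have "\<not> invertible A"
    by (simp add: invertible_det_nz)
  then obtain x where "A *v x = 0" "x \<noteq> 0"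
    by (auto simp: invertible_left_inverse matrix_left_invertible_ker)
  then have "norm (x /\<^sub>R norm x) = 1" "A *v (x /\<^sub>R norm x) = 0"
    by (simp_all add: matrix_vector_mult_scaleR)
  then show thesis by (rule that)
qed

text \<open>The quadratic form at \<open>v\<close> is the pairing of \<open>E\<close> with the
  projection \<open>P\<close> onto \<open>v\<close>. A traceless \<open>E\<close> is orthogonal to
  the identity, so \<open>P\<close> may be replaced by its shorter traceless part
  \<open>W\<close>.\<close>

lemma trace_free_quadratic_form_bound:
  fixes E :: "real^'n^'n"
  assumes "trace E = 0" "norm v = 1"
  shows "(v \<bullet> (E *v v))\<^sup>2 \<le> (1 - 1 / real CARD('n)) * (E \<bullet> E)"
proof -
  define P :: "real^'n^'n" where "P = (\<chi> i j. v $ i * v $ j)"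
  define W :: "real^'n^'n" where "W = P - (1 / real CARD('n)) *\<^sub>R mat 1"
  have quad: "B \<bullet> P = v \<bullet> (B *v v)" for B :: "real^'n^'n"
    by (simp add: inner_matrix P_def inner_vec_def matrix_vector_mult_def sum_distrib_left mult_ac)
  have vv: "v \<bullet> v = 1"
    using assms(2) by (simp add: norm_eq_1)
  have "P *v v = v"
    using vv by (simp add: P_def matrix_vector_mult_def vec_eq_iff inner_vec_def mult.assoc
        flip: sum_distrib_left)
  \<comment> \<open>Both \<open>P \<bullet> P\<close> and \<open>P \<bullet> mat 1\<close> equal 1,
    so the value is 1 - 2/d + 1/d.\<close>
  then have "W \<bullet> W = 1 - 1 / real CARD('n)"
    using quad[of P] quad[of "mat 1"] inner_mat_1[of "mat 1 :: real^'n^'n"] vv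
    by (simp add: W_def inner_diff_left inner_diff_right inner_commute[of P "mat 1"] trace_I)
  moreover have "E \<bullet> W = v \<bullet> (E *v v)"
    using assms(1) by (simp add: W_def inner_diff_right quad inner_mat_1)
  ultimately show ?thesis
    using Cauchy_Schwarz_ineq[of E W] by (simp add: mult.commute)
qed

section \<open>The quantities \<open>S_I\<close> and \<open>S_R\<close> as Frobenius norms\<close>

lemma S_I_eq:
  fixes \<rho> :: "complex^'n^'n"
  assumes "hermitian \<rho>"
  shows "sqrt (real CARD('n)) * S_I \<rho> = norm (Im_matrix (real CARD('n) *\<^sub>R \<rho>))"
proof -
  \<comment> \<open>The entries are imaginary and skew-symmetric; the two resulting signs
    cancel.\<close>
  have "Re (I_part \<rho> $ i $ j * I_part \<rho> $ j $ i) = (real CARD('n) * Im (\<rho> $ i $ j))\<^sup>2" for i j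
  proof -
    have "Re (\<rho> $ j $ i) = Re (\<rho> $ i $ j)" "Im (\<rho> $ j $ i) = - Im (\<rho> $ i $ j)"
      using hermitian_component[OF assms, of i j] by (auto simp: complex_eq_iff)
    then show ?thesis
      by (simp add: I_part_def transpose_def power2_eq_square)
  qed
  then have "Re (trace (I_part \<rho> ** I_part \<rho>)) =
      Im_matrix (real CARD('n) *\<^sub>R \<rho>) \<bullet> Im_matrix (real CARD('n) *\<^sub>R \<rho>)"
    by (simp only: trace_def matrix_matrix_mult_def inner_matrix Im_matrix_def vec_lambda_beta Re_sum)
       (simp add: power2_eq_square)
  then show ?thesis
    by (simp add: S_I_def norm_eq_sqrt_inner real_sqrt_divide)
qed

lemma S_R_eq:
  fixes \<rho> :: "complex^'n^'n"
  assumes "hermitian \<rho>"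
  shows "real CARD('n) * (S_R \<rho>)\<^sup>2 =
    (Re_matrix (real CARD('n) *\<^sub>R \<rho>) - mat 1) \<bullet> (Re_matrix (real CARD('n) *\<^sub>R \<rho>) - mat 1)"
proof -
  let ?E = "Re_matrix (real CARD('n) *\<^sub>R \<rho>) - mat 1"
  have D: "Re (D_part \<rho> $ i $ j * D_part \<rho> $ j $ i) = (if i = j then (?E $ i $ j)\<^sup>2 else 0)" for i j
    using hermitian_component[OF assms, of i j]
    by (auto simp: D_part_def R_part_def transpose_def Re_matrix_def mat_def complex_eq_iff
        power2_eq_square)
  have X: "Re (X_part \<rho> $ i $ j * X_part \<rho> $ j $ i) = (if i = j then 0 else (?E $ i $ j)\<^sup>2)" for i j
    using hermitian_component[OF assms, of i j]
    by (auto simp: X_part_def R_part_def transpose_def Re_matrix_def mat_def complex_eq_iff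
        power2_eq_square)
  have trD: "Re (trace (D_part \<rho> ** D_part \<rho>)) =
      (\<Sum>i\<in>UNIV. \<Sum>j\<in>UNIV. if i = j then (?E $ i $ j)\<^sup>2 else 0)"
    by (simp only: trace_def matrix_matrix_mult_def vec_lambda_beta Re_sum D)
  have trX: "Re (trace (X_part \<rho> ** X_part \<rho>)) =
      (\<Sum>i\<in>UNIV. \<Sum>j\<in>UNIV. if i = j then 0 else (?E $ i $ j)\<^sup>2)"
    by (simp only: trace_def matrix_matrix_mult_def vec_lambda_beta Re_sum X)
  \<comment> \<open>Nonnegativity lets squaring remove the square roots; the squared norms then add
    because the two parts have disjoint supports.\<close>
  have "0 \<le> Re (trace (D_part \<rho> ** D_part \<rho>))" "0 \<le> Re (trace (X_part \<rho> ** X_part \<rho>))"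
    unfolding trD trX by (auto intro!: sum_nonneg)
  then have "real CARD('n) * (S_R \<rho>)\<^sup>2 =
      Re (trace (D_part \<rho> ** D_part \<rho>)) + Re (trace (X_part \<rho> ** X_part \<rho>))"
    by (simp add: S_R_def S_D_def S_X_def field_simps)
  also have "\<dots> = (\<Sum>i\<in>UNIV. \<Sum>j\<in>UNIV. (?E $ i $ j)\<^sup>2)"
    unfolding trD trX sum.distrib[symmetric] by (intro sum.cong refl) simp
  also have "\<dots> = ?E \<bullet> ?E"
    by (simp add: inner_matrix power2_eq_square)
  finally show ?thesis .
qed

theorem proposition2:
  fixes \<rho> :: "complex^'n^'n"
  assumes "CARD('n) \<ge> 3" and "odd CARD('n)"
    and "quantum_state \<rho>"
    and "S_R \<rho> \<le> 1 / sqrt (real CARD('n) - 1)"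
  shows "sqrt (real CARD('n)) * S_I \<rho> \<le> sqrt (real CARD('n) - 1) + S_R \<rho>"
proof -
  define d s where "d = real CARD('n)" and "s = S_R \<rho>"
  define M where "M = d *\<^sub>R \<rho>"
  define E where "E = Re_matrix M - mat 1"
  have d: "d \<ge> 3" using assms(1) by (simp add: d_def)
  have s: "s \<ge> 0" by (simp add: s_def S_R_def)
  have psd: "pos_semidef \<rho>" and herm: "hermitian \<rho>" and tr: "trace \<rho> = 1"
    using assms(3) by (auto simp: quantum_state_def pos_semidef_def)
  have "hermitian M"
    using herm by (simp add: M_def hermitian_def conj_transpose_def vec_eq_iff)
  moreover have "sesqui M x x = d *\<^sub>R sesqui \<rho> x x" for x
    by (simp add: sesqui_double_sum M_def scaleR_sum_right)
  ultimately have psdM: "pos_semidef M"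
    using psd d by (simp add: pos_semidef_sesqui)
  have "transpose (Im_matrix M) = - Im_matrix M"
    using hermitian_component[OF \<open>hermitian M\<close>]
    by (simp add: transpose_def Im_matrix_def vec_eq_iff complex_eq_iff)
  then obtain v where v: "norm v = 1" "Im_matrix M *v v = 0"
    using odd_skew_symmetric_kernel assms(2) by blast
  define a where "a = v \<bullet> (E *v v)"
  have trR: "trace (Re_matrix M) = d"
    using tr by (simp add: trace_def Re_matrix_def M_def complex_eq_iff flip: sum_distrib_left)
  then have trE: "trace E = 0"
    by (simp add: E_def trace_sub trace_I d_def)
  have EE: "E \<bullet> E = d * s\<^sup>2"
    using S_R_eq[OF herm] by (simp add: E_def M_def d_def s_def)
  have "v \<bullet> (Re_matrix M *v v) = 1 + a"
    using v(1) by (simp add: a_def E_def matrix_vector_mult_diff_rdistrib inner_diff_right norm_eq_1)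
  \<comment> \<open>Pythagoras: \<open>E\<close> is traceless, hence orthogonal to the identity,
    whose squared norm is \<open>d\<close>.\<close>
  moreover have "Re_matrix M \<bullet> Re_matrix M = d + d * s\<^sup>2"
  proof -
    have "Re_matrix M = mat 1 + E" by (simp add: E_def)
    then show ?thesis
      using trE EE by (simp add: inner_add_left inner_add_right inner_mat_1 inner_commute[of "mat 1" E]
          trace_add trace_I d_def)
  qed
  ultimately have main: "Im_matrix M \<bullet> Im_matrix M \<le> d + d * s\<^sup>2 - (1 + a)\<^sup>2"
    using pos_semidef_real_kernel_bound[OF psdM v] by simp
  define t where "t = sqrt (d - 1) * s"
  have t: "0 \<le> t" "t \<le> 1" "t\<^sup>2 = (d - 1) * s\<^sup>2"
    using d s assms(4) by (auto simp: t_def power_mult_distrib field_simps d_def[symmetric] s_def[symmetric])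
  have "a\<^sup>2 \<le> (1 - 1 / d) * (d * s\<^sup>2)"
    using trace_free_quadratic_form_bound[OF trE v(1)] EE by (simp add: a_def d_def)
  also have "\<dots> = t\<^sup>2"
    using d by (simp add: t(3) field_simps)
  finally have "\<bar>a\<bar> \<le> t"
    using t(1) abs_le_square_iff[of a t] by simp
  \<comment> \<open>Squaring preserves the order because \<open>t \<le> 1\<close>, which is the
    hypothesis on \<open>S_R\<close>.\<close>
  then have "(1 - t)\<^sup>2 \<le> (1 + a)\<^sup>2"
    using t by (intro power_mono) auto
  then have "Im_matrix M \<bullet> Im_matrix M \<le> d + d * s\<^sup>2 - (1 - t)\<^sup>2"
    using main by linarith
  \<comment> \<open>Inserting the value of \<open>t\<^sup>2\<close> leaves
    \<open>(d - 1) + 2 * t + s\<^sup>2\<close>, and \<open>2 * t\<close> is the cross term.\<close>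
  also have "\<dots> = (sqrt (d - 1) + s)\<^sup>2"
    using t(3) d by (simp add: power2_sum power2_diff t_def algebra_simps)
  finally have "norm (Im_matrix M) \<le> sqrt (d - 1) + s"
    using s d by (simp add: norm_eq_sqrt_inner real_le_lsqrt)
  then show ?thesis
    using S_I_eq[OF herm] by (simp add: M_def d_def s_def)
qed

end
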